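(* Let $(\mathscr{R}_n(x))_{n\ge 0}$ be the polynomials defined by $\mathscr{R}_0(x)=1$ and $$\mathscr{R}_{n+1}(x)=(2nx+1)x\,\mathscr{R}_n(x)+x(1-x^2)\,\frac{d}{dx}\mathscr{R}_n(x)\qquad (n\ge 0)$$ (so $\mathscr{R}_1(x)=x$). Then $\mathscr{R}_n(x)$ is Hurwitz stable for every $n\in\mathbb{N}$.
   Context: $\mathbb{N}$ denotes the nonnegative integers. A polynomial $f\in\mathbb{C}[x]$ is Hurwitz stable if it is identically zero or $f(x)\ne 0$ whenever $\Re(x)>0$. (The coefficient of $x^k$ in $\mathscr{R}_n(x)$ counts the elements with $k$ alternating runs in a dual set of Stirling permutations of order $n$; this is not needed for the statement.) *)

theory Defs
  imports Complex_Main "HOL-Computational_Algebra.Polynomial"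
begin

primrec alt_run_poly :: "nat \<Rightarrow> complex poly" where
  "alt_run_poly 0 = 1"
| "alt_run_poly (Suc n) =
     (let x = [:0, 1:] in
       (of_nat (2 * n) * x + 1) * x * alt_run_poly n
       + x * (1 - x ^ 2) * pderiv (alt_run_poly n))"

text \<open>Weak stability: zeros on the imaginary axis are allowed.\<close>

definition hurwitz_stable :: "complex poly \<Rightarrow> bool" where
  "hurwitz_stable f \<longleftrightarrow> f = 0 \<or> (\<forall>z. Re z > 0 \<longrightarrow> poly f z \<noteq> 0)"

lemma alt_run_poly_1: "alt_run_poly 1 = [:0, 1:]"
  by simp

end

theory Submission
  imports Defs "HOL-Computational_Algebra.Fundamental_Theorem_Algebra"
begin

text \<open>
  If \<open>f\<close> has degree \<open>d \<le> 2 * n\<close>, with zeros \<open>r\<close> in the closed left half-plane, then the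
  recursion gives
  \<open>T f / (x * f) = 1 + (2 * n - d) * x + (\<Sum>r. x + (1 - x\<^sup>2) / (x - r))\<close>.
  Each summand equals \<open>(1 - x * r) / (x - r)\<close>, whose real part is positive for
  \<open>Re x > 0\<close> and \<open>Re r \<le> 0\<close>, so the whole quotient has real part at least 1.
\<close>

lemma Re_linear_factor_nonneg:
  fixes z r :: complex
  assumes "Re z > 0" and "Re r \<le> 0"
  shows "Re (z + (1 - z ^ 2) / (z - r)) \<ge> 0"
proof -
  have "z \<noteq> r"
    using assms by auto
  then have "z + (1 - z ^ 2) / (z - r) = (1 - z * r) / (z - r)"
    by (simp add: field_simps power2_eq_square)
  \<comment> \<open>The quotient has the sign of this product in its real part. The product expands
    to \<open>cnj z - cnj r - |z|^2 * r + |r|^2 * z\<close>, where every term has nonnegative real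
    part.\<close>
  moreover have "Re ((1 - z * r) * cnj (z - r)) =
      Re z + (- Re r) + ((Re z)\<^sup>2 + (Im z)\<^sup>2) * (- Re r) + ((Re r)\<^sup>2 + (Im r)\<^sup>2) * Re z"
    by (simp add: algebra_simps power2_eq_square)
  moreover have "\<dots> \<ge> 0"
    using assms by (intro add_nonneg_nonneg mult_nonneg_nonneg) auto
  ultimately show ?thesis
    by (simp add: Re_complex_div_ge_0)
qed

text \<open>Induction on the degree splits off one zero at a time, so multiplicities need no
  bookkeeping. The logarithmic derivative is additive over the factors, and each linear factor takes
  one copy of \<open>z\<close> from \<open>degree f * z\<close>.\<close>

lemma Re_log_derivative_nonneg:
  fixes f :: "complex poly"
  assumes "\<And>w. Re w > 0 \<Longrightarrow> poly f w \<noteq> 0" and "Re z > 0"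
  shows "Re (of_nat (degree f) * z + (1 - z ^ 2) * (poly (pderiv f) z / poly f z)) \<ge> 0"
  using assms(1)
proof (induction "degree f" arbitrary: f)
  case 0
  then have "pderiv f = 0"
    by (simp add: pderiv_eq_0_iff)
  with 0 show ?case
    by simp
next
  case (Suc d)
  then have "\<not> constant (poly f)"
    by (simp add: constant_degree)
  then obtain r where r: "poly f r = 0"
    using fundamental_theorem_of_algebra by blast
  then obtain g where f: "f = [:- r, 1:] * g"
    by (auto simp: poly_eq_0_iff_dvd)
  have "Re r \<le> 0"
    using r Suc.prems by (meson not_le)
  have g_nz: "poly g w \<noteq> 0" if "Re w > 0" for w
    using Suc.prems[OF that] by (auto simp: f)
  then have "g \<noteq> 0"
    using assms(2) by auto
  then have deg: "degree f = Suc (degree g)"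
    unfolding f by (subst degree_mult_eq) auto
  then have IH: "Re (of_nat (degree g) * z + (1 - z ^ 2) * (poly (pderiv g) z / poly g z)) \<ge> 0"
    using Suc.hyps g_nz by simp
  have nz: "z - r \<noteq> 0" "poly g z \<noteq> 0"
    using \<open>Re r \<le> 0\<close> assms(2) g_nz by auto
  have pderiv_f: "poly (pderiv f) z = (z - r) * poly (pderiv g) z + poly g z"
    unfolding f pderiv_mult by (simp add: pderiv_pCons algebra_simps)
  have poly_f: "poly f z = (z - r) * poly g z"
    by (simp add: f algebra_simps)
  have "poly (pderiv f) z / poly f z = 1 / (z - r) + poly (pderiv g) z / poly g z"
    unfolding pderiv_f poly_f using nz by (simp add: add_divide_distrib)
  then have "of_nat (degree f) * z + (1 - z ^ 2) * (poly (pderiv f) z / poly f z) =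
      (z + (1 - z ^ 2) / (z - r)) +
      (of_nat (degree g) * z + (1 - z ^ 2) * (poly (pderiv g) z / poly g z))"
    by (simp add: deg algebra_simps add_divide_distrib diff_divide_distrib)
  then show ?case
    using IH Re_linear_factor_nonneg[OF assms(2) \<open>Re r \<le> 0\<close>] by simp
qed

text \<open>Writing both multipliers as coefficient lists lets \<open>simp\<close> compute their
  degrees and values.\<close>

lemma alt_run_poly_Suc:
  "alt_run_poly (Suc n) =
     [:0, 1, of_nat (2 * n):] * alt_run_poly n + [:0, 1, 0, -1:] * pderiv (alt_run_poly n)"
proof -
  have "(of_nat (2 * n) * [:0, 1:] + 1) * [:0, 1:] = ([:0, 1, of_nat (2 * n):] :: complex poly)"
    by (simp add: of_nat_poly one_pCons del: of_nat_mult)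
  moreover have "[:0, 1:] * (1 - [:0, 1:] ^ 2) = ([:0, 1, 0, -1:] :: complex poly)"
    by (simp add: one_pCons power2_eq_square)
  ultimately show ?thesis
    by (simp only: alt_run_poly.simps Let_def)
qed

text \<open>Each step raises the degree by at most 2: the cubic multiplier acts on a derivative,
  which has lost one degree.\<close>

lemma degree_alt_run_poly_le: "degree (alt_run_poly n) \<le> 2 * n"
proof (induction n)
  case 0
  show ?case by simp
next
  case (Suc n)
  have "degree ([:0, 1, of_nat (2 * n):] * alt_run_poly n) \<le> 2 * Suc n"
    by (rule order_trans[OF degree_mult_le])
      (use Suc in simp)
  moreover have "degree ([:0, 1, 0, -1:] * pderiv (alt_run_poly n)) \<le> 2 * Suc n"
  \<comment> \<open>For a constant, \<open>degree - 1\<close> truncates to 0, and the estimate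
    \<open>3 + 0\<close> would exceed \<open>2 * Suc n\<close> at \<open>n = 0\<close>.\<close>
  proof (cases "degree (alt_run_poly n) = 0")
    case True
    then have "pderiv (alt_run_poly n) = 0"
      by (simp add: pderiv_eq_0_iff)
    then show ?thesis
      by simp
  next
    case False
    have "degree ([:0, 1, 0, -1:] * pderiv (alt_run_poly n)) \<le> 3 + (degree (alt_run_poly n) - 1)"
      by (rule order_trans[OF degree_mult_le]) (simp add: degree_pderiv)
    also have "\<dots> \<le> 2 * Suc n"
      using False Suc by simp
    finally show ?thesis .
  qed
  ultimately show ?case
    unfolding alt_run_poly_Suc by (rule degree_add_le)
qed

text \<open>The point \<open>z\<close> is generalized in the induction because the bound on
  \<open>?L\<close> needs \<open>?f\<close> to have no zero anywhere in the open right
  half-plane.\<close>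

lemma alt_run_poly_nonzero:
  assumes "Re z > 0"
  shows "poly (alt_run_poly n) z \<noteq> 0"
  using assms
proof (induction n arbitrary: z)
  case 0
  show ?case by simp
next
  case (Suc n)
  let ?f = "alt_run_poly n"
  let ?L = "of_nat (degree ?f) * z + (1 - z ^ 2) * (poly (pderiv ?f) z / poly ?f z)"
  have nz: "poly ?f z \<noteq> 0" "z \<noteq> 0"
    using Suc by auto
  \<comment> \<open>The degree bound makes this natural subtraction exact.\<close>
  have "of_nat (2 * n) = of_nat (2 * n - degree ?f) + (of_nat (degree ?f) :: complex)"
    using degree_alt_run_poly_le[of n] by (simp flip: of_nat_add)
  then have "poly (alt_run_poly (Suc n)) z =
      z * poly ?f z * (1 + of_nat (2 * n - degree ?f) * z + ?L)"
    unfolding alt_run_poly_Suc using nz by (simp add: field_simps power2_eq_square)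
  moreover have "Re (1 + of_nat (2 * n - degree ?f) * z + ?L) > 0"
  proof -
    have "Re ?L \<ge> 0"
      by (rule Re_log_derivative_nonneg[OF Suc.IH Suc.prems])
    moreover have "Re (of_nat (2 * n - degree ?f) * z) \<ge> 0"
      using Suc.prems by simp
    ultimately show ?thesis
      unfolding plus_complex.sel by simp
  qed
  ultimately show ?case
    using nz by (metis less_irrefl mult_eq_0_iff zero_complex.sel(1))
qed

theorem proposition2p16:
  fixes n :: nat
  shows "hurwitz_stable (alt_run_poly n)"
  unfolding hurwitz_stable_def using alt_run_poly_nonzero by blast

end
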